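(* For every integer $t\ge 3$, $$m(P_{2t})\le \frac{(2t)!}{2}-\left\lfloor \frac{t^2}{4}\right\rfloor (2t-2)!.$$ In particular, as $t\to\infty$, $$m(P_{2t})\le \left(\frac{7}{8}+o(1)\right)\frac{(2t)!}{2},$$ where $o(1)$ denotes a quantity tending to $0$ as $t\to\infty$.
   Context: $P_n$ denotes the path on $n$ vertices. For a graph $H$, the Ramsey number $r(H)$ is the minimum positive integer $n$ such that every red/blue edge-coloring of the complete graph $K_n$ contains a monochromatic copy of $H$. The threshold Ramsey multiplicity $m(H)$ is the minimum, over all red/blue edge-colorings of $K_{r(H)}$, of the total number of monochromatic copies of $H$ (the number of red copies plus the number of blue copies). A copy of $H$ is an (unlabelled) subgraph of the complete graph isomorphic to $H$; in particular a path and its reversal are the same copy. *)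

theory Defs
  imports Complex_Main "HOL-Library.Ramsey"
begin

text \<open>A simple graph is a pair of its vertex set and its edge set, the edges being
  2-element sets of vertices.\<close>

type_synonym 'a graph = "'a set \<times> 'a set set"

abbreviation verts :: "'a graph \<Rightarrow> 'a set" where "verts G \<equiv> fst G"

abbreviation edges :: "'a graph \<Rightarrow> 'a set set" where "edges G \<equiv> snd G"

definition simple_graph :: "'a graph \<Rightarrow> bool" where
  "simple_graph G \<longleftrightarrow> edges G \<subseteq> nsets (verts G) 2"

definition subgraph :: "'a graph \<Rightarrow> 'a graph \<Rightarrow> bool" where
  "subgraph G H \<longleftrightarrow> simple_graph G \<and> verts G \<subseteq> verts H \<and> edges G \<subseteq> edges H"

definition isomorphic :: "'a graph \<Rightarrow> 'b graph \<Rightarrow> bool" where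
  "isomorphic G H \<longleftrightarrow>
     (\<exists>f. bij_betw f (verts G) (verts H) \<and>
          (\<forall>u\<in>verts G. \<forall>v\<in>verts G. {u, v} \<in> edges G \<longleftrightarrow> {f u, f v} \<in> edges H))"

definition complete_graph :: "nat \<Rightarrow> nat graph" where
  "complete_graph n = ({..<n}, nsets {..<n} 2)"

definition path_graph :: "nat \<Rightarrow> nat graph" where
  "path_graph n = ({..<n}, {{i, Suc i} | i. Suc i < n})"

text \<open>Colourings are total functions on sets of vertices; only the values on the edges of the
  complete graph under consideration matter.\<close>

datatype colour = Red | Blue

type_synonym colouring = "nat set \<Rightarrow> colour"

text \<open>The copies are the subgraphs themselves, not the embeddings, so that for instance a path and
  its reversal count once.\<close>

definition mono_copies :: "'a graph \<Rightarrow> nat \<Rightarrow> colouring \<Rightarrow> colour \<Rightarrow> nat graph set" where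
  "mono_copies H n \<chi> k =
     {G. subgraph G (complete_graph n) \<and> isomorphic H G \<and> (\<forall>e\<in>edges G. \<chi> e = k)}"

definition ramsey_number :: "'a graph \<Rightarrow> nat" where
  "ramsey_number H = (LEAST n. 0 < n \<and> (\<forall>\<chi>. \<exists>k. mono_copies H n \<chi> k \<noteq> {}))"

definition num_mono_copies :: "'a graph \<Rightarrow> nat \<Rightarrow> colouring \<Rightarrow> nat" where
  "num_mono_copies H n \<chi> = card (mono_copies H n \<chi> Red) + card (mono_copies H n \<chi> Blue)"

definition threshold_mult :: "'a graph \<Rightarrow> nat" where
  "threshold_mult H = (LEAST m. \<exists>\<chi>. m = num_mono_copies H (ramsey_number H) \<chi>)"

end

theory Submission
  imports Defs
begin

text \<open>By the theorem of Gerencser and Gyarfas, \<open>r(P_2t) = 3t - 1\<close>. For the upper bound we induct on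
  \<open>t\<close>: take a longest monochromatic, say red, path; it may be assumed to have \<open>2t - 2\<close> or \<open>2t - 1\<close>
  vertices, so at least \<open>t\<close> vertices lie outside. Both of its ends are joined in blue to all of them,
  and of two consecutive vertices of the path one is joined in blue to any given outside vertex;
  this suffices to thread a blue path through \<open>t\<close> outside vertices.

  On \<open>3t - 1\<close> vertices, let \<open>A\<close> have \<open>2t\<close> of them and \<open>B\<close> the others. Colour the edges between \<open>A\<close> and
  \<open>B\<close> blue and all others red, except that in \<open>A\<close> a star with centre \<open>0\<close> and \<open>s = \<lfloor>t / 2\<rfloor>\<close> leaves is blue.
  Counting directed paths in units of \<open>(2t - 2)!\<close>, there are \<open>(2t - 1 - s)(2t - s)\<close> red ones, and
  \<open>2st\<close> and \<open>s(s - 1)\<close> blue ones which use one and two edges of the star. The total is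
  \<open>2t(2t - 1) - 2s(t - s)\<close>.\<close>

section \<open>Copies of paths as vertex sequences\<close>

text \<open>Directed paths: a copy of \<open>path_graph m\<close> with \<open>2 \<le> m\<close> is
  listed from either end.\<close>

definition mono_paths :: "nat \<Rightarrow> nat \<Rightarrow> colouring \<Rightarrow> colour \<Rightarrow> nat list set" where
  "mono_paths m n \<chi> k =
     {xs. length xs = m \<and> distinct xs \<and> set xs \<subseteq> {..<n} \<and> successively (\<lambda>u v. \<chi> {u, v} = k) xs}"

definition path_of :: "'a list \<Rightarrow> 'a graph" where
  "path_of xs = (set xs, {{xs ! i, xs ! Suc i} | i. Suc i < length xs})"

lemma finite_mono_paths: "finite (mono_paths m n \<chi> k)"
  by (rule finite_subset[OF _ finite_lists_length_eq[of "{..<n}" m]]) (auto simp: mono_paths_def)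

lemma path_of_rev: "path_of (rev xs) = path_of xs"
proof -
  have sub: "snd (path_of (rev ys)) \<subseteq> snd (path_of ys)" for ys :: "'a list"
  proof
    fix e assume "e \<in> snd (path_of (rev ys))"
    then obtain i where i: "Suc i < length ys" "e = {rev ys ! i, rev ys ! Suc i}"
      by (auto simp: path_of_def)
    define j where "j = length ys - Suc (Suc i)"
    have "rev ys ! i = ys ! Suc j" "rev ys ! Suc i = ys ! j" "Suc j < length ys"
      using i by (auto simp: rev_nth j_def Suc_diff_Suc)
    then show "e \<in> snd (path_of ys)" using i by (auto simp: path_of_def)
  qed
  have "snd (path_of (rev xs)) = snd (path_of xs)"
    using sub[of xs] sub[of "rev xs"] by auto
  then show ?thesis by (auto simp: path_of_def prod_eq_iff)
qed

lemma rev_mono_paths: "xs \<in> mono_paths m n \<chi> k \<Longrightarrow> rev xs \<in> mono_paths m n \<chi> k"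
  by (auto simp: mono_paths_def insert_commute)

lemma isomorphic_path_of:
  assumes "distinct xs" "length xs = m"
  shows "isomorphic (path_graph m) (path_of xs)"
  unfolding isomorphic_def
proof (intro exI conjI ballI)
  show "bij_betw ((!) xs) (verts (path_graph m)) (verts (path_of xs))"
    using bij_betw_nth[OF assms(1), of "{..<m}" "set xs"] assms by (auto simp: path_graph_def path_of_def)
  fix u v assume "u \<in> verts (path_graph m)" "v \<in> verts (path_graph m)"
  then have uv: "u < length xs" "v < length xs" using assms by (auto simp: path_graph_def)
  have eq: "{xs ! u, xs ! v} = {xs ! i, xs ! Suc i} \<longleftrightarrow> {u, v} = {i, Suc i}" if "Suc i < length xs" for i
    using that uv assms(1) by (auto simp: doubleton_eq_iff nth_eq_iff_index_eq)
  show "{u, v} \<in> edges (path_graph m) \<longleftrightarrow> {xs ! u, xs ! v} \<in> edges (path_of xs)"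
    using eq assms(2) by (auto simp: path_graph_def path_of_def)
qed

text \<open>The vertices of \<open>G\<close> are listed in the order in which an isomorphism visits
  them.\<close>

lemma isomorphic_path_graphD:
  assumes "simple_graph G" "isomorphic (path_graph m) G"
  obtains xs where "length xs = m" "distinct xs" "G = path_of xs"
proof -
  obtain f where f: "bij_betw f {..<m} (verts G)"
    and e: "\<And>u v. u < m \<Longrightarrow> v < m \<Longrightarrow> {u, v} \<in> edges (path_graph m) \<longleftrightarrow> {f u, f v} \<in> edges G"
    using assms(2) by (auto simp: isomorphic_def path_graph_def)
  define xs where "xs = map f [0..<m]"
  have "distinct xs" using f by (simp add: xs_def distinct_map bij_betw_def atLeast0LessThan)
  moreover have set: "set xs = verts G" using f by (simp add: xs_def bij_betw_def atLeast0LessThan)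
  moreover have "edges G = edges (path_of xs)"
  proof
    show "edges G \<subseteq> edges (path_of xs)"
    proof
      fix a assume a: "a \<in> edges G"
      \<comment> \<open>An isomorphism only compares pairs of vertices; \<open>simple_graph\<close>
        rules out any other edge of \<open>G\<close>.\<close>
      then have "a \<in> nsets (verts G) 2" using assms(1) by (auto simp: simple_graph_def)
      then obtain x y where xy: "a = {x, y}" "x \<in> verts G" "y \<in> verts G"
        by (auto simp: nsets_def card_2_iff)
      then obtain i j where ij: "x = f i" "y = f j" "i < m" "j < m"
        using f by (metis bij_betw_imp_surj_on imageE lessThan_iff)
      then have "{i, j} \<in> edges (path_graph m)" using e a xy by auto
      then obtain l where l: "{i, j} = {l, Suc l}" "Suc l < m" by (auto simp: path_graph_def)
      then have "a = {xs ! l, xs ! Suc l}" using ij xy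
        by (auto simp: doubleton_eq_iff xs_def)
      moreover have "Suc l < length xs" using l by (simp add: xs_def)
      ultimately show "a \<in> edges (path_of xs)" by (auto simp: path_of_def)
    qed
    show "edges (path_of xs) \<subseteq> edges G"
    proof
      fix a assume "a \<in> edges (path_of xs)"
      then obtain i where i: "Suc i < m" "a = {f i, f (Suc i)}"
        by (auto simp: path_of_def xs_def)
      then show "a \<in> edges G" using e[of i "Suc i"] by (auto simp: path_graph_def)
    qed
  qed
  ultimately show thesis
    by (intro that[of xs]) (auto simp: xs_def path_of_def prod_eq_iff)
qed

lemma mono_copies_path: "mono_copies (path_graph m) n \<chi> k = path_of ` mono_paths m n \<chi> k"
proof (intro equalityI subsetI)
  fix G assume G: "G \<in> mono_copies (path_graph m) n \<chi> k"
  then obtain xs where xs: "length xs = m" "distinct xs" "G = path_of xs"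
    using isomorphic_path_graphD[of G m] by (auto simp: mono_copies_def subgraph_def)
  then show "G \<in> path_of ` mono_paths m n \<chi> k" using G
    by (auto simp: mono_copies_def mono_paths_def subgraph_def complete_graph_def path_of_def
      successively_conv_nth intro!: image_eqI[of _ _ xs])
next
  fix G assume "G \<in> path_of ` mono_paths m n \<chi> k"
  then obtain xs where xs: "length xs = m" "distinct xs" "G = path_of xs" "set xs \<subseteq> {..<n}"
      "successively (\<lambda>u v. \<chi> {u, v} = k) xs"
    by (auto simp: mono_paths_def)
  have "edges G \<subseteq> nsets (set xs) 2"
    using xs(1-3) by (fastforce simp: path_of_def nsets_def card_2_iff nth_eq_iff_index_eq)
  moreover have "nsets (set xs) 2 \<subseteq> nsets {..<n} 2" using xs(4) by (rule nsets_mono)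
  ultimately show "G \<in> mono_copies (path_graph m) n \<chi> k"
    using xs isomorphic_path_of[OF xs(2,1)]
    by (auto simp: mono_copies_def subgraph_def simple_graph_def complete_graph_def path_of_def
      successively_conv_nth)
qed

text \<open>Each copy is sent to a chosen listing and to its reversal. Both determine the copy, and
  for \<open>2 \<le> m\<close> they differ because the first and the last vertex are
  distinct.\<close>

lemma double_card_mono_copies_le:
  assumes "2 \<le> m"
  shows "2 * card (mono_copies (path_graph m) n \<chi> k) \<le> card (mono_paths m n \<chi> k)"
proof -
  let ?C = "mono_copies (path_graph m) n \<chi> k" and ?P = "mono_paths m n \<chi> k"
  have fin: "finite ?C" by (simp add: mono_copies_path finite_mono_paths)
  define g where "g = inv_into ?P path_of"
  have g: "g G \<in> ?P \<and> path_of (g G) = G" if "G \<in> ?C" for G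
    using that unfolding mono_copies_path g_def by (auto intro: inv_into_into f_inv_into_f)
  define h where "h = (\<lambda>(G, b). if b then g G else rev (g G))"
  have "h ` (?C \<times> UNIV) \<subseteq> ?P"
    using g rev_mono_paths by (auto simp: h_def)
  moreover have "inj_on h (?C \<times> UNIV)"
  proof (rule inj_onI)
    fix p q assume p: "p \<in> ?C \<times> UNIV" and q: "q \<in> ?C \<times> UNIV" and eq: "h p = h q"
    have "path_of (h p) = fst p" "path_of (h q) = fst q"
      using g p q by (auto simp: h_def path_of_rev split: prod.splits)
    then have fst: "fst p = fst q" using eq by simp
    define xs where "xs = g (fst p)"
    have xs: "length xs = m" "distinct xs"
      using g[of "fst p"] p by (auto simp: mono_paths_def xs_def)
    then have "rev xs ! 0 = xs ! (m - 1)" using assms by (simp add: rev_nth)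
    moreover have "xs ! (m - 1) \<noteq> xs ! 0" using xs assms by (simp add: nth_eq_iff_index_eq)
    ultimately have "rev xs \<noteq> xs" by metis
    then have "snd p = snd q"
      using eq fst by (auto simp: h_def xs_def split: prod.splits if_splits)
    with fst show "p = q" by (simp add: prod_eq_iff)
  qed
  ultimately have "card (?C \<times> (UNIV :: bool set)) \<le> card ?P"
    by (meson card_inj_on_le finite_mono_paths)
  then show ?thesis by (simp add: card_cartesian_product)
qed

section \<open>The Ramsey number of an even path\<close>

text \<open>The invariant of the absorption below: an end in \<open>U\<close> can be continued
  through any vertex joined to all of \<open>U\<close>. Single vertices of \<open>U\<close> are the
  starting case.\<close>

definition linked :: "('a \<Rightarrow> 'a \<Rightarrow> bool) \<Rightarrow> 'a set \<Rightarrow> 'a list \<Rightarrow> bool" where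
  "linked E U q \<longleftrightarrow> q \<noteq> [] \<and> successively E q \<and> hd q \<in> U \<and> last q \<in> U"

text \<open>The pair at the head of \<open>ps\<close> provides a common neighbour for two of any three vertices
  of \<open>U\<close>; apply this to an end of each of the two paths and a fresh vertex. If the two paths get
  merged, the fresh vertex becomes the second path.\<close>

lemma absorb_pairs:
  assumes "symp E"
    and "length ps = 2 * n" "\<forall>u\<in>U. successively (\<lambda>x y. E u x \<or> E u y) ps"
    and "finite F" "F \<subseteq> U" "card F = n" "distinct (q1 @ q2 @ ps)" "F \<inter> set (q1 @ q2 @ ps) = {}"
    and "linked E U q1" "linked E U q2"
  shows "\<exists>r1 r2. linked E U r1 \<and> linked E U r2 \<and> distinct (r1 @ r2) \<and>
           set (r1 @ r2) \<subseteq> set (q1 @ q2 @ ps) \<union> F \<and>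
           length r1 + length r2 = length q1 + length q2 + 2 * n"
  using assms(2-)
proof (induction n arbitrary: ps F q1 q2)
  case 0
  then show ?case by (intro exI[of _ q1] exI[of _ q2]) auto
next
  case (Suc n)
  obtain a b ps' where ps: "ps = a # b # ps'" "length ps' = 2 * n"
    using Suc.prems(1) by (cases ps; cases "tl ps") auto
  obtain u where u: "u \<in> F" using Suc.prems(5) by fastforce
  define F' where "F' = F - {u}"
  have F': "finite F'" "F' \<subseteq> U" "card F' = n" using Suc.prems u by (auto simp: F'_def)
  have U: "u \<in> U" "last q1 \<in> U" "hd q2 \<in> U" using Suc.prems u by (auto simp: linked_def)
  have adj: "E v a \<or> E v b" if "v \<in> U" for v
    using Suc.prems(2) that by (auto simp: ps)
  have sym: "E x y \<Longrightarrow> E y x" for x y using assms(1) by (auto dest: sympD)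
  have ps': "\<forall>u\<in>U. successively (\<lambda>x y. E u x \<or> E u y) ps'"
    using Suc.prems(2) by (auto simp: ps successively_Cons)
  \<comment> \<open>One round of the induction: the new paths gain two vertices in total, taken from
    \<open>a\<close>, \<open>b\<close> and \<open>u\<close>.\<close>
  have step: ?case
    if "linked E U q1'" "linked E U q2'" "distinct (q1' @ q2')"
      "set (q1' @ q2') \<subseteq> set (q1 @ q2) \<union> {a, b, u}"
      "length q1' + length q2' = length q1 + length q2 + 2" for q1' q2'
  proof -
    have "distinct (q1' @ q2' @ ps')" "F' \<inter> set (q1' @ q2' @ ps') = {}"
      using that Suc.prems u unfolding ps F'_def by auto
    from Suc.IH[OF ps(2) ps' F' this that(1,2)] obtain r1 r2
      where r: "linked E U r1" "linked E U r2" "distinct (r1 @ r2)"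
        "set (r1 @ r2) \<subseteq> set (q1' @ q2' @ ps') \<union> F'"
        "length r1 + length r2 = length q1' + length q2' + 2 * n" by blast
    have "set (r1 @ r2) \<subseteq> set (q1 @ q2 @ ps) \<union> F"
      using r(4) that(4) u unfolding ps F'_def by auto
    with r that show ?thesis by (intro exI[of _ r1] exI[of _ r2]) auto
  qed
  have ex: "\<exists>p\<in>{a, b}. E (last q1) p \<and> E (hd q2) p \<or> E (last q1) p \<and> E u p \<or> E (hd q2) p \<and> E u p"
    using adj[OF U(1)] adj[OF U(2)] adj[OF U(3)] by auto
  then obtain p where p: "p \<in> {a, b}"
    "E (last q1) p \<and> E (hd q2) p \<or> E (last q1) p \<and> E u p \<or> E (hd q2) p \<and> E u p" by blast
  have fresh: "p \<notin> set q1" "p \<notin> set q2" "u \<notin> set q1" "u \<notin> set q2" "u \<noteq> p"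
    using p(1) u Suc.prems(6,7) by (auto simp: ps)
  have q: "q1 \<noteq> []" "q2 \<noteq> []" "successively E q1" "successively E q2" "hd q1 \<in> U" "last q2 \<in> U"
      "set q1 \<inter> set q2 = {}" "distinct q1" "distinct q2"
    using Suc.prems by (auto simp: linked_def)
  from p(2) show ?case
  proof (elim disjE)
    assume "E (last q1) p \<and> E (hd q2) p"
    then show ?case using p(1) fresh q U
      by (intro step[of "q1 @ p # q2" "[u]"])
        (auto simp: linked_def successively_append_iff successively_Cons sym)
  next
    assume "E (last q1) p \<and> E u p"
    then show ?case using p(1) fresh q U
      by (intro step[of "q1 @ [p, u]" q2])
        (auto simp: linked_def successively_append_iff successively_Cons sym)
  next
    assume "E (hd q2) p \<and> E u p"
    then show ?case using p(1) fresh q U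
      by (intro step[of q1 "u # p # q2"])
        (auto simp: linked_def successively_append_iff successively_Cons sym)
  qed
qed

text \<open>A vertex outside \<open>xs\<close> with \<open>R\<close>-edges to an end, or to two
  consecutive vertices, could be inserted into \<open>xs\<close>, against \<open>max\<close>. So in
  the complement of \<open>R\<close> both ends are joined to all outside vertices, and the interior
  satisfies the hypothesis of \<open>absorb_pairs\<close>. The two paths obtained from there are
  strung together by the ends \<open>x\<close> and \<open>y\<close>.\<close>

lemma complementary_path_of_maximal_path:
  fixes R :: "'a \<Rightarrow> 'a \<Rightarrow> bool"
  assumes "symp R" "finite V" "2 \<le> t" "3 * t - 1 \<le> card V"
    and xs: "distinct xs" "set xs \<subseteq> V" "successively R xs" "2 * t - 2 \<le> length xs" "length xs \<le> 2 * t - 1"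
    and max: "\<And>ys. distinct ys \<Longrightarrow> set ys \<subseteq> V \<Longrightarrow> successively R ys \<Longrightarrow> length ys \<noteq> Suc (length xs)"
  shows "\<exists>ys. distinct ys \<and> set ys \<subseteq> V \<and> successively (\<lambda>x y. \<not> R x y) ys \<and> length ys = 2 * t"
proof -
  define E where "E = (\<lambda>x y. \<not> R x y)"
  have symE: "symp E" using assms(1) by (auto simp: E_def symp_def)
  have sym: "E x y \<Longrightarrow> E y x" for x y using symE by (auto dest: sympD)
  obtain x zs where "xs = x # zs" "zs \<noteq> []" using xs(4) assms(3) by (cases xs; cases "tl xs") auto
  then obtain mid y where xs_eq: "xs = x # mid @ [y]" by (metis rev_exhaust)
  define U where "U = V - set xs"
  have "card U = card V - length xs"
    using xs(1,2) assms(2) by (simp add: U_def card_Diff_subset distinct_card)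
  then have cardU: "t \<le> card U" using assms(3,4) xs(5) by linarith
  have endx: "E u x" if "u \<in> U" for u
  proof (rule ccontr)
    assume "\<not> E u x"
    then show False using max[of "u # xs"] xs that
      by (auto simp: E_def U_def xs_eq)
  qed
  have endy: "E u y" if "u \<in> U" for u
  proof (rule ccontr)
    assume "\<not> E u y"
    then have "R y u" using assms(1) by (auto simp: E_def dest: sympD)
    then have "successively R (xs @ [u])"
      using xs(3) unfolding successively_append_iff by (simp add: xs_eq)
    then show False using max[of "xs @ [u]"] xs(1,2) that
      by (auto simp: U_def)
  qed
  have inner: "E u a \<or> E u b" if "u \<in> U" "xs = l @ a # b # r" for u a b l r
  proof (rule ccontr)
    assume "\<not> (E u a \<or> E u b)"
    then have "R a u" "R u b" using assms(1) by (auto simp: E_def dest: sympD)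
    then show False using max[of "l @ a # u # b # r"] xs that
      by (auto simp: U_def successively_append_iff successively_Cons)
  qed
  \<comment> \<open>The interior has \<open>2 * t - 4\<close> or \<open>2 * t - 3\<close> vertices;
    \<open>t - 2\<close> pairs are kept, which drops at most one vertex.\<close>
  define ps where "ps = take (2 * (t - 2)) mid"
  have lps: "length ps = 2 * (t - 2)" using xs(4) assms(3) by (auto simp: ps_def xs_eq)
  have psmid: "mid = ps @ drop (2 * (t - 2)) mid" by (simp add: ps_def)
  have pairs: "\<forall>u\<in>U. successively (\<lambda>a b. E u a \<or> E u b) ps"
  proof (intro ballI)
    fix u assume u: "u \<in> U"
    have "E u (ps ! i) \<or> E u (ps ! Suc i)" if i: "Suc i < length ps" for i
    proof -
      have "ps = take i ps @ ps ! i # ps ! Suc i # drop (Suc (Suc i)) ps"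
        using i by (metis Cons_nth_drop_Suc Suc_lessD append_take_drop_id)
      then have "xs = (x # take i ps) @ ps ! i # ps ! Suc i # (drop (Suc (Suc i)) ps @ drop (2 * (t - 2)) mid @ [y])"
        using xs_eq psmid by (metis append.assoc append_Cons)
      then show ?thesis using inner u by blast
    qed
    then show "successively (\<lambda>a b. E u a \<or> E u b) ps" by (auto simp: successively_conv_nth)
  qed
  \<comment> \<open>Of \<open>t\<close> outside vertices, \<open>u\<close> and \<open>v\<close>
    serve as the two initial paths and the other \<open>t - 2\<close> as fresh vertices, one for
    each pair.\<close>
  obtain W where W: "W \<subseteq> U" "card W = t" using cardU obtain_subset_with_card_n by blast
  have "finite W" using W(2) assms(3) by (metis card.infinite not_numeral_le_zero)
  obtain W2 where "W2 \<subseteq> W" "card W2 = 2"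
    using obtain_subset_with_card_n[of 2 W] W(2) assms(3) by auto
  then obtain u v where uv: "u \<in> W" "v \<in> W" "u \<noteq> v" by (auto simp: card_2_iff)
  have xy: "x \<notin> U" "y \<notin> U" "x \<notin> set ps" "y \<notin> set ps" "x \<noteq> y" "distinct ps" "set ps \<inter> U = {}"
    using xs(1) set_take_subset[of "2 * (t - 2)" mid] by (auto simp: U_def xs_eq ps_def)
  have psV: "set ps \<subseteq> V" "x \<in> V" "y \<in> V"
    using xs(2) set_take_subset[of "2 * (t - 2)" mid] by (auto simp: xs_eq ps_def)
  have "finite (W - {u, v})" "W - {u, v} \<subseteq> U" "card (W - {u, v}) = t - 2"
       "distinct ([u] @ [v] @ ps)" "(W - {u, v}) \<inter> set ([u] @ [v] @ ps) = {}"
       "linked E U [u]" "linked E U [v]"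
    using \<open>finite W\<close> W uv xy by (auto simp: linked_def card_Diff_subset)
  from absorb_pairs[OF symE lps pairs this] obtain r1 r2 where
    r: "linked E U r1" "linked E U r2" "distinct (r1 @ r2)"
       "set (r1 @ r2) \<subseteq> set ([u] @ [v] @ ps) \<union> (W - {u, v})"
       "length r1 + length r2 = length [u] + length [v] + 2 * (t - 2)" by blast
  have rset: "set r1 \<union> set r2 \<subseteq> set ps \<union> U" using r(4) W(1) uv by auto
  define ys where "ys = x # r1 @ y # r2"
  have "distinct ys" using r(3) rset xy by (auto simp: ys_def)
  moreover have "set ys \<subseteq> V" using rset psV by (auto simp: ys_def U_def)
  moreover have "successively E ys"
    using r(1,2) endx endy by (auto simp: ys_def linked_def successively_Cons successively_append_iff intro: sym)
  moreover have "length ys = 2 * t" using r(5) assms(3) by (simp add: ys_def)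
  ultimately show ?thesis unfolding E_def by blast
qed

lemma monochromatic_even_path:
  fixes R :: "'a \<Rightarrow> 'a \<Rightarrow> bool"
  assumes "symp R" "finite V" "1 \<le> t" "3 * t - 1 \<le> card V"
  shows "\<exists>b ys. distinct ys \<and> set ys \<subseteq> V \<and> successively (\<lambda>x y. R x y = b) ys \<and> length ys = 2 * t"
  using assms(3,4)
proof (induction t rule: nat_induct_at_least)
  case base
  then obtain W where "W \<subseteq> V" "card W = 2" by (metis obtain_subset_with_card_n diff_Suc_1 mult.right_neutral numeral_3_eq_3 numeral_2_eq_2)
  then obtain u v where "u \<in> V" "v \<in> V" "u \<noteq> v" by (auto simp: card_2_iff)
  then show ?case by (intro exI[of _ "R u v"] exI[of _ "[u, v]"]) auto
next
  case (Suc t)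
  have "3 * t - 1 \<le> card V" using Suc.prems by simp
  then obtain b ys where ys: "distinct ys" "set ys \<subseteq> V" "successively (\<lambda>x y. R x y = b) ys" "length ys = 2 * t"
    using Suc.IH by fastforce
  define P where "P = (\<lambda>k. \<exists>zs. distinct zs \<and> set zs \<subseteq> V \<and> successively (\<lambda>x y. R x y = b) zs \<and> length zs = k)"
  have P: "P (2 * t)" using ys unfolding P_def by blast
  have step: ?case if "P k" "\<not> P (Suc k)" "k = 2 * t \<or> k = Suc (2 * t)" for k
  proof -
    obtain zs where zs: "distinct zs" "set zs \<subseteq> V" "successively (\<lambda>x y. R x y = b) zs" "length zs = k"
      using \<open>P k\<close> by (auto simp: P_def)
    have "\<exists>ys. distinct ys \<and> set ys \<subseteq> V \<and> successively (\<lambda>x y. \<not> (R x y = b)) ys \<and> length ys = 2 * Suc t"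
    proof (rule complementary_path_of_maximal_path)
      show "symp (\<lambda>x y. R x y = b)" using assms(1) by (auto simp: symp_def)
      show "length ws \<noteq> Suc (length zs)" if "distinct ws" "set ws \<subseteq> V" "successively (\<lambda>x y. R x y = b) ws" for ws
        using \<open>\<not> P (Suc k)\<close> that zs(4) unfolding P_def by blast
    qed (use zs that Suc.hyps Suc.prems assms(2) in auto)
    then show ?thesis by (intro exI[of _ "\<not> b"]) (auto elim!: successively_mono)
  qed
  show ?case
  proof (cases "P (Suc (2 * t)) \<and> P (Suc (Suc (2 * t)))")
    case True
    then show ?thesis by (auto simp: P_def)
  next
    case False
    then show ?thesis using step[of "2 * t"] step[of "Suc (2 * t)"] P by blast
  qed
qed

section \<open>Lists alternating between two classes or staying in one\<close>

lemma length_filter_alternating: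
  assumes "successively (\<lambda>x y. P x \<noteq> P y) xs"
  shows "length (filter P xs) =
    (if xs \<noteq> [] \<and> P (hd xs) then (length xs + 1) div 2 else length xs div 2)"
  using assms
proof (induction xs)
  case (Cons x xs)
  then show ?case by (cases xs) auto
qed simp

text \<open>This lets blue paths be counted as arrangements: the two subsequences and the class of
  the first entry recover the list.\<close>

lemma alternating_splice:
  assumes "successively (\<lambda>x y. P x \<noteq> P y) xs"
  shows "xs = (if xs \<noteq> [] \<and> P (hd xs) then splice (filter P xs) (filter (\<lambda>x. \<not> P x) xs)
               else splice (filter (\<lambda>x. \<not> P x) xs) (filter P xs))"
  using assms
proof (induction xs)
  case (Cons x xs)
  then show ?case by (cases xs) (auto split: if_splits)
qed simp

lemma successively_same_class:
  assumes "successively (\<lambda>x y. P x = P y) xs"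
  shows "(\<forall>x\<in>set xs. P x) \<or> (\<forall>x\<in>set xs. \<not> P x)"
  using assms
proof (induction xs)
  case (Cons x xs)
  then show ?case by (cases xs) auto
qed simp

section \<open>The value of the Ramsey number\<close>

lemma mono_copies_even_path_nonempty:
  assumes "1 \<le> t"
  shows "\<exists>k. mono_copies (path_graph (2 * t)) (3 * t - 1) \<chi> k \<noteq> {}"
proof -
  obtain b ys where ys: "distinct ys" "set ys \<subseteq> {..<3 * t - 1}"
      "successively (\<lambda>x y. (\<chi> {x, y} = Red) = b) ys" "length ys = 2 * t"
    using monochromatic_even_path[of "\<lambda>x y. \<chi> {x, y} = Red" "{..<3 * t - 1}" t] assms
    by (auto simp: symp_def insert_commute)
  have "(\<chi> {x, y} = Red) = b \<longleftrightarrow> \<chi> {x, y} = (if b then Red else Blue)" for x y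
    by (cases "\<chi> {x, y}") auto
  then have "ys \<in> mono_paths (2 * t) (3 * t - 1) \<chi> (if b then Red else Blue)"
    using ys by (auto simp: mono_paths_def)
  then show ?thesis unfolding mono_copies_path by blast
qed

text \<open>For the lower bound, at most \<open>3 * t - 2\<close> vertices are split into those
  below \<open>2 * t - 1\<close> and at most \<open>t - 1\<close> others, with red inside the
  classes and blue between them. A red path stays in one class, which is too small; a blue path
  alternates and would need \<open>t\<close> vertices of the second class.\<close>

lemma ramsey_number_even_path:
  assumes "1 \<le> t"
  shows "ramsey_number (path_graph (2 * t)) = 3 * t - 1"
  unfolding ramsey_number_def
proof (rule Least_equality)
  show "0 < 3 * t - 1 \<and> (\<forall>\<chi>. \<exists>k. mono_copies (path_graph (2 * t)) (3 * t - 1) \<chi> k \<noteq> {})"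
    using mono_copies_even_path_nonempty assms by auto
next
  fix n assume n: "0 < n \<and> (\<forall>\<chi>. \<exists>k. mono_copies (path_graph (2 * t)) n \<chi> k \<noteq> {})"
  show "3 * t - 1 \<le> n"
  proof (rule ccontr)
    assume "\<not> 3 * t - 1 \<le> n"
    define P where "P = (\<lambda>x. x < 2 * t - 1)"
    define \<chi> where "\<chi> = (\<lambda>e. if (\<exists>x\<in>e. P x) \<and> (\<exists>x\<in>e. \<not> P x) then Blue else Red)"
    have \<chi>: "\<chi> {u, v} = Red \<longleftrightarrow> P u = P v" "\<chi> {u, v} = Blue \<longleftrightarrow> P u \<noteq> P v" for u v
      by (auto simp: \<chi>_def)
    obtain k xs where xs: "xs \<in> mono_paths (2 * t) n \<chi> k"
      using n unfolding mono_copies_path by blast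
    then have len: "length xs = 2 * t" "distinct xs" "set xs \<subseteq> {..<n}"
      by (auto simp: mono_paths_def)
    have size: "length ys \<le> 2 * t - 1" if "distinct ys" "set ys \<subseteq> {..<n}" "\<forall>x\<in>set ys. P x" for ys
      using card_mono[of "{..<2 * t - 1}" "set ys"] that by (auto simp: P_def distinct_card)
    have size': "length ys \<le> t - 1" if "distinct ys" "set ys \<subseteq> {..<n}" "\<forall>x\<in>set ys. \<not> P x" for ys
    proof -
      have "set ys \<subseteq> {2 * t - 1..<n}" using that by (auto simp: P_def not_less)
      then have "length ys \<le> n - (2 * t - 1)"
        using card_mono[of "{2 * t - 1..<n}" "set ys"] that(1) by (auto simp: distinct_card)
      then show ?thesis using \<open>\<not> 3 * t - 1 \<le> n\<close> by linarith
    qed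
    show False
    proof (cases k)
      case Red
      then have "successively (\<lambda>x y. P x = P y) xs" using xs by (simp add: mono_paths_def \<chi>)
      then show False
        using successively_same_class[of P xs] size[of xs] size'[of xs] len assms by auto
    next
      case Blue
      then have "successively (\<lambda>x y. P x \<noteq> P y) xs" using xs by (simp add: mono_paths_def \<chi>)
      then have "t \<le> length (filter (\<lambda>x. \<not> P x) xs)"
        using length_filter_alternating[of "\<lambda>x. \<not> P x" xs] len by auto
      moreover have "length (filter (\<lambda>x. \<not> P x) xs) \<le> t - 1"
        using len by (intro size') auto
      ultimately show False using assms by linarith
    qed
  qed
qed

section \<open>Counting the monochromatic paths of the star colouring\<close>

definition arrangements :: "nat \<Rightarrow> 'a set \<Rightarrow> 'a list set" where
  "arrangements k A = {xs. length xs = k \<and> distinct xs \<and> set xs \<subseteq> A}"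

lemma finite_arrangements: "finite A \<Longrightarrow> finite (arrangements k A)"
  by (rule finite_subset[OF _ finite_lists_length_eq[of A k]]) (auto simp: arrangements_def)

text \<open>A falling factorial in a form free of division. The blue count meets just this product,
  with \<open>fact (card A - k)\<close> as the number of orders of the other class.\<close>

lemma card_arrangements:
  assumes "finite A" "k \<le> card A"
  shows "card (arrangements k A) * fact (card A - k) = fact (card A)"
proof -
  let ?n = "card A"
  have "card (arrangements k A) = \<Prod>{?n - k + 1..?n}"
    using card_lists_distinct_length_eq[OF assms] by (simp add: arrangements_def)
  moreover have "{1..?n} = {1..?n - k} \<union> {?n - k + 1..?n}" "{1..?n - k} \<inter> {?n - k + 1..?n} = {}"
    using assms(2) by auto
  then have "\<Prod>{1..?n} = \<Prod>{1..?n - k} * \<Prod>{?n - k + 1..?n}"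
    by (metis finite_atLeastAtMost prod.union_disjoint)
  ultimately show ?thesis by (simp add: fact_prod)
qed

lemma card_arrangements_all:
  assumes "finite A" "k = card A"
  shows "card (arrangements k A) = fact k"
  using card_arrangements[of A k] assms by simp

text \<open>With \<open>s = 0\<close> and \<open>2 \<le> t\<close>, the monochromatic paths on
  \<open>2 * t\<close> of the \<open>3 * t - 1\<close> vertices are the \<open>fact (2 * t)\<close>
  red orderings of \<open>{..<2 * t}\<close>. For \<open>0 < s < t\<close> the star destroys more
  red paths than it creates blue ones.\<close>

definition star_colouring :: "nat \<Rightarrow> nat \<Rightarrow> colouring" where
  "star_colouring t s e =
     (if (\<exists>x\<in>e. x < 2 * t) \<and> (\<exists>x\<in>e. \<not> x < 2 * t) \<or> (\<exists>i\<in>{1..s}. e = {0, i}) then Blue else Red)"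

lemma star_colouring_Blue:
  "star_colouring t s {u, v} = Blue \<longleftrightarrow>
     (u < 2 * t) \<noteq> (v < 2 * t) \<or> u = 0 \<and> v \<in> {1..s} \<or> v = 0 \<and> u \<in> {1..s}"
  by (auto simp: star_colouring_def doubleton_eq_iff)

lemma star_colouring_Red:
  "star_colouring t s {u, v} = Red \<longleftrightarrow>
     (u < 2 * t) = (v < 2 * t) \<and> \<not> (u = 0 \<and> v \<in> {1..s}) \<and> \<not> (v = 0 \<and> u \<in> {1..s})"
  using star_colouring_Blue[of t s u v] by (cases "star_colouring t s {u, v}") auto

lemma card_SIGMA_le:
  assumes "finite A" "card A \<le> a" "\<And>x. x \<in> A \<Longrightarrow> card (B x) \<le> b" "\<And>x. x \<in> A \<Longrightarrow> finite (B x)"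
  shows "card (SIGMA x:A. B x) \<le> a * b"
proof -
  have "card (SIGMA x:A. B x) = (\<Sum>x\<in>A. card (B x))" using assms by simp
  also have "\<dots> \<le> card A * b" using sum_bounded_above[of A "\<lambda>x. card (B x)" b] assms(3) by simp
  also have "\<dots> \<le> a * b" using assms(2) by simp
  finally show ?thesis .
qed

text \<open>Both colours are counted through three families of codes; for an upper bound it suffices
  that the codes reach every path.\<close>

lemma card_le_three_images:
  assumes "P \<subseteq> f ` A \<union> g ` B \<union> h ` C" "finite A" "finite B" "finite C"
  shows "card P \<le> card A + card B + card C"
proof -
  have "card P \<le> card (f ` A \<union> g ` B \<union> h ` C)" using assms by (intro card_mono) auto
  also have "\<dots> \<le> card (f ` A) + card (g ` B) + card (h ` C)"
    using card_Un_le[of "f ` A \<union> g ` B" "h ` C"] card_Un_le[of "f ` A" "g ` B"] by linarith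
  also have "\<dots> \<le> card A + card B + card C" using assms by (intro add_mono card_image_le)
  finally show ?thesis .
qed

section \<open>Red paths\<close>

text \<open>No red edge leaves \<open>{..<2 * t}\<close>, and the other class has only
  \<open>t - 1\<close> vertices, so a red path orders all of \<open>{..<2 * t}\<close>. The
  neighbours of \<open>0\<close> on it avoid the leaves of the star. With
  \<open>m = 2 * t - 1 - s\<close> choices for such a neighbour, the cases of \<open>0\<close> in
  front, at the back and inside add up to \<open>2 * m + m * (m - 1) = m * (m + 1)\<close> units of
  \<open>fact (2 * t - 2)\<close>.\<close>

lemma card_red_paths_le:
  assumes "2 \<le> t" "s < 2 * t"
  shows "card (mono_paths (2 * t) (3 * t - 1) (star_colouring t s) Red)
    \<le> (2 * t - 1 - s) * (2 * t - s) * fact (2 * t - 2)"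
proof -
  let ?A = "{..<2 * t}" and ?P = "mono_paths (2 * t) (3 * t - 1) (star_colouring t s) Red"
  define T where "T = {s<..<2 * t}"
  have T: "finite T" "card T = 2 * t - 1 - s" by (auto simp: T_def)
  define D1 where "D1 = (SIGMA a:T. arrangements (2 * t - 2) (?A - {0, a}))"
  \<comment> \<open>\<open>p\<close> is the place of the block \<open>[a, 0, b]\<close> among the
    other \<open>2 * t - 3\<close> vertices.\<close>
  define D2 where "D2 = (SIGMA a:T. SIGMA b:T - {a}. {..<2 * t - 2} \<times> arrangements (2 * t - 3) (?A - {0, a, b}))"
  have sub: "?P \<subseteq> (\<lambda>(a, us). 0 # a # us) ` D1 \<union> (\<lambda>(a, us). us @ [a, 0]) ` D1 \<union>
    (\<lambda>(a, b, p, us). take p us @ [a, 0, b] @ drop p us) ` D2"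
  proof
    fix xs assume "xs \<in> ?P"
    then have xs: "length xs = 2 * t" "distinct xs" "set xs \<subseteq> {..<3 * t - 1}"
        and red: "successively (\<lambda>u v. star_colouring t s {u, v} = Red) xs"
      by (auto simp: mono_paths_def)
    have "successively (\<lambda>u v. (u < 2 * t) = (v < 2 * t)) xs"
      using red by (rule successively_mono) (simp add: star_colouring_Red)
    then have "(\<forall>x\<in>set xs. x < 2 * t) \<or> (\<forall>x\<in>set xs. \<not> x < 2 * t)"
      by (rule successively_same_class)
    moreover have "\<not> (\<forall>x\<in>set xs. \<not> x < 2 * t)"
    proof
      assume "\<forall>x\<in>set xs. \<not> x < 2 * t"
      then have "set xs \<subseteq> {2 * t..<3 * t - 1}" using xs(3) by force
      then have "card (set xs) \<le> card {2 * t..<3 * t - 1}" by (intro card_mono) auto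
      then show False using xs assms(1) by (simp add: distinct_card)
    qed
    ultimately have "set xs \<subseteq> ?A" by auto
    then have set: "set xs = ?A" using xs by (intro card_subset_eq) (auto simp: distinct_card)
    then have "0 \<in> set xs" using assms(1) by auto
    then obtain ys zs where eq: "xs = ys @ 0 # zs" by (auto dest: split_list)
    have inT: "x \<in> T" if "x < 2 * t" "x \<noteq> 0" "star_colouring t s {0, x} = Red" for x
      using that by (auto simp: star_colouring_Red T_def)
    have inT': "x \<in> T" if "x < 2 * t" "x \<noteq> 0" "star_colouring t s {x, 0} = Red" for x
      using that inT by (simp add: insert_commute)
    consider (first) "ys = []" | (last) "zs = []" | (mid) "ys \<noteq> []" "zs \<noteq> []" by blast
    then show "xs \<in> (\<lambda>(a, us). 0 # a # us) ` D1 \<union> (\<lambda>(a, us). us @ [a, 0]) ` D1 \<union>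
      (\<lambda>(a, b, p, us). take p us @ [a, 0, b] @ drop p us) ` D2"
    proof cases
      case first
      then obtain a us where zs: "zs = a # us" using eq xs(1) assms(1) by (cases zs) auto
      have "a \<in> T" using red xs set by (intro inT) (auto simp: eq first zs)
      then have "(a, us) \<in> D1" using xs \<open>set xs \<subseteq> ?A\<close> by (auto simp: D1_def arrangements_def eq first zs)
      then show ?thesis by (auto simp: eq first zs intro!: image_eqI[of _ _ "(a, us)"])
    next
      case last
      then obtain a us where ys: "ys = us @ [a]" using eq xs(1) assms(1) by (cases ys rule: rev_cases) auto
      have "a \<in> T" using red xs \<open>set xs \<subseteq> ?A\<close>
        by (intro inT') (auto simp: eq last ys successively_append_iff)
      then have "(a, us) \<in> D1" using xs \<open>set xs \<subseteq> ?A\<close> by (auto simp: D1_def arrangements_def eq last ys)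
      then show ?thesis by (auto simp: eq last ys intro!: image_eqI[of _ _ "(a, us)"])
    next
      case mid
      then obtain a b us ws where ys: "ys = us @ [a]" and zs: "zs = b # ws"
        by (metis list.exhaust rev_exhaust)
      have "a \<in> T" using red xs \<open>set xs \<subseteq> ?A\<close>
        by (intro inT') (auto simp: eq ys zs successively_append_iff)
      moreover have "b \<in> T" using red xs \<open>set xs \<subseteq> ?A\<close>
        by (intro inT) (auto simp: eq ys zs successively_append_iff)
      ultimately have "(a, b, length us, us @ ws) \<in> D2" using xs \<open>set xs \<subseteq> ?A\<close>
        by (auto simp: D2_def arrangements_def eq ys zs)
      then show ?thesis by (auto simp: eq ys zs intro!: image_eqI[of _ _ "(a, b, length us, us @ ws)"])
    qed
  qed
  have fin: "finite D1" "finite D2"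
    unfolding D1_def D2_def using T(1) by (auto intro!: finite_SigmaI finite_arrangements)
  have "card D1 \<le> (2 * t - 1 - s) * fact (2 * t - 2)"
    unfolding D1_def
  proof (rule card_SIGMA_le)
    fix a assume "a \<in> T"
    then show "card (arrangements (2 * t - 2) (?A - {0, a})) \<le> fact (2 * t - 2)"
      by (subst card_arrangements_all) (auto simp: T_def card_Diff_subset)
  qed (auto simp: T finite_arrangements)
  moreover have "card D2 \<le> (2 * t - 1 - s) * ((2 * t - 2 - s) * ((2 * t - 2) * fact (2 * t - 3)))"
    unfolding D2_def
  proof (rule card_SIGMA_le)
    fix a assume a: "a \<in> T"
    show "card (SIGMA b:T - {a}. {..<2 * t - 2} \<times> arrangements (2 * t - 3) (?A - {0, a, b}))
      \<le> (2 * t - 2 - s) * ((2 * t - 2) * fact (2 * t - 3))"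
    proof (rule card_SIGMA_le)
      fix b assume "b \<in> T - {a}"
      then show "card ({..<2 * t - 2} \<times> arrangements (2 * t - 3) (?A - {0, a, b})) \<le> (2 * t - 2) * fact (2 * t - 3)"
        unfolding card_cartesian_product using a
        by (subst card_arrangements_all) (auto simp: T_def card_Diff_subset)
    qed (use a in \<open>auto simp: T finite_arrangements\<close>)
  qed (auto simp: T finite_arrangements)
  moreover have "(2 * t - 2) * fact (2 * t - 3) = (fact (2 * t - 2) :: nat)"
    using assms(1) fact_reduce[of "2 * t - 2", where 'a = nat] by (simp add: numeral_3_eq_3 numeral_2_eq_2)
  ultimately have D: "card D1 \<le> (2 * t - 1 - s) * fact (2 * t - 2)"
    "card D2 \<le> (2 * t - 1 - s) * ((2 * t - 2 - s) * fact (2 * t - 2))" by auto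
  have "card ?P \<le> card D1 + card D1 + card D2"
    using sub fin by (intro card_le_three_images)
  also have "\<dots> \<le> (2 * t - 1 - s) * ((2 + (2 * t - 2 - s)) * fact (2 * t - 2))"
    using D by (simp add: algebra_simps)
  also have "(2 * t - 1 - s) * ((2 + (2 * t - 2 - s)) * fact (2 * t - 2))
      = (2 * t - 1 - s) * (2 * t - s) * (fact (2 * t - 2) :: nat)"
  \<comment> \<open>At \<open>s = 2 * t - 1\<close> truncated subtraction makes the second factors
    differ, but the first factor is zero.\<close>
  proof (cases "s = 2 * t - 1")
    case False
    then have "2 + (2 * t - 2 - s) = 2 * t - s" using assms by linarith
    then show ?thesis by (simp add: mult.assoc)
  qed simp
  finally show ?thesis .
qed


section \<open>Blue paths\<close>

text \<open>A block is the vertex \<open>0\<close> with its neighbours along star edges. Contracting the block of a blue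
  path to \<open>0\<close> leaves a sequence that alternates between \<open>{..<2 * t}\<close> and its complement, i.e. a
  \<^const>\<open>splice\<close>; \<open>expand\<close> undoes the contraction.\<close>

definition blocks2 :: "nat \<Rightarrow> nat list set" where
  "blocks2 s = (\<lambda>a. [0, a]) ` {1..s} \<union> (\<lambda>a. [a, 0]) ` {1..s}"

definition blocks3 :: "nat \<Rightarrow> nat list set" where
  "blocks3 s = (\<lambda>(a, b). [a, 0, b]) ` (SIGMA a:{1..s}. {1..s} - {a})"

definition expand :: "nat list \<Rightarrow> nat list \<Rightarrow> nat list" where
  "expand c ws = concat (map (\<lambda>x. if x = 0 then c else [x]) ws)"

lemma expand_id: "0 \<notin> set ys \<Longrightarrow> expand c ys = ys"
  by (induction ys) (auto simp: expand_def)

lemma expand_split: "0 \<notin> set ys \<Longrightarrow> 0 \<notin> set zs \<Longrightarrow> expand c (ys @ 0 # zs) = ys @ c @ zs"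
  using expand_id[of ys c] expand_id[of zs c] by (simp add: expand_def)

text \<open>A path that alternates throughout would need \<open>t\<close> of the
  \<open>t - 1\<close> vertices outside \<open>{..<2 * t}\<close>. Hence a blue path uses a star
  edge, and alternation fails only next to \<open>0\<close>. A leaf next to \<open>0\<close> joins
  the block; as it lies in the class of \<open>0\<close>, letting \<open>0\<close> take its place
  keeps the alternation.\<close>

lemma blue_path_contraction:
  assumes "xs \<in> mono_paths (2 * t) (3 * t - 1) (star_colouring t s) Blue" "1 \<le> t" "s < 2 * t"
  obtains ys c zs where "xs = ys @ c @ zs" "0 \<notin> set ys" "0 \<notin> set zs" "c \<in> blocks2 s \<union> blocks3 s"
    "successively (\<lambda>u v. (u < 2 * t) \<noteq> (v < 2 * t)) (ys @ 0 # zs)"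
proof -
  let ?D = "\<lambda>u v. (u < 2 * t) \<noteq> (v < 2 * t)"
  have xs: "length xs = 2 * t" "distinct xs" "set xs \<subseteq> {..<3 * t - 1}"
      and blue: "successively (\<lambda>u v. star_colouring t s {u, v} = Blue) xs"
    using assms(1) by (auto simp: mono_paths_def)
  have not_alt: "\<not> successively ?D xs"
  proof
    assume "successively ?D xs"
    then have "length (filter (\<lambda>x. \<not> x < 2 * t) xs) = t"
      using length_filter_alternating[of "\<lambda>x. \<not> x < 2 * t" xs] xs(1) by auto
    moreover have "length (filter (\<lambda>x. \<not> x < 2 * t) xs) = card (set (filter (\<lambda>x. \<not> x < 2 * t) xs))"
      using distinct_card[OF distinct_filter[OF xs(2)]] by simp
    moreover have "\<dots> \<le> card {2 * t..<3 * t - 1}" using xs(3) by (intro card_mono) auto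
    ultimately show False using assms(2) by simp
  qed
  have alt: "successively ?D l" if "successively (\<lambda>u v. star_colouring t s {u, v} = Blue) l" "0 \<notin> set l" for l
    using that(1) by (rule successively_mono) (use that(2) in \<open>auto simp: star_colouring_Blue\<close>)
  have "0 \<in> set xs" using alt blue not_alt by blast
  then obtain ys zs where eq: "xs = ys @ 0 # zs" by (auto dest: split_list)
  have 0: "0 \<notin> set ys" "0 \<notin> set zs" using xs(2) by (auto simp: eq)
  have b: "successively ?D ys" "successively ?D zs"
    using blue 0 alt[of ys] alt[of zs] by (auto simp: eq successively_append_iff successively_Cons)
  have adj: "?D 0 x \<or> x \<in> {1..s}" if "star_colouring t s {0, x} = Blue \<or> star_colouring t s {x, 0} = Blue" for x
    using that assms(2) by (auto simp: star_colouring_Blue)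
  have l: "ys = [] \<or> ?D (last ys) 0 \<or> last ys \<in> {1..s}"
    using blue adj[of "last ys"] by (auto simp: eq successively_append_iff)
  have r: "zs = [] \<or> ?D 0 (hd zs) \<or> hd zs \<in> {1..s}"
    using blue adj[of "hd zs"] by (auto simp: eq successively_append_iff successively_Cons)
  have star: "x < 2 * t" if "x \<in> {1..s}" for x using that assms(3) by auto
  \<comment> \<open>\<open>L\<close> and \<open>R\<close> tell whether the path enters and leaves
    \<open>0\<close> along a star edge. Neither contradicts \<open>not_alt\<close>, exactly one
    gives \<open>blocks2\<close>, both give \<open>blocks3\<close>.\<close>
  define L where "L \<longleftrightarrow> ys \<noteq> [] \<and> last ys \<in> {1..s}"
  define R where "R \<longleftrightarrow> zs \<noteq> [] \<and> hd zs \<in> {1..s}"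
  have D0: "?D 0 x \<longleftrightarrow> \<not> x < 2 * t" "?D x 0 \<longleftrightarrow> \<not> x < 2 * t" for x using assms(2) by auto
  consider "\<not> L" "\<not> R" | "L" "\<not> R" | "\<not> L" "R" | "L" "R" by blast
  then show thesis
  proof cases
    case 1
    then have "successively ?D xs" using b l r
      by (auto simp: eq successively_append_iff successively_Cons L_def R_def)
    then show ?thesis using not_alt by blast
  next
    case 2
    then obtain ys' a where ys: "ys = ys' @ [a]" "a \<in> {1..s}"
      unfolding L_def by (metis append_butlast_last_id)
    have "successively ?D (ys' @ 0 # zs)" using b r 2 star[OF ys(2)] D0
      by (auto simp: ys successively_append_iff successively_Cons R_def)
    then show ?thesis using that[of ys' "[a, 0]" zs] 0 ys by (auto simp: eq blocks2_def)
  next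
    case 3
    then obtain zs' a where zs: "zs = a # zs'" "a \<in> {1..s}"
      unfolding R_def by (metis list.collapse)
    have "successively ?D (ys @ 0 # zs')" using b l 3 star[OF zs(2)] D0
      by (auto simp: zs successively_append_iff successively_Cons L_def)
    then show ?thesis using that[of ys "[0, a]" zs'] 0 zs by (auto simp: eq blocks2_def)
  next
    case 4
    then obtain ys' a zs' b where ys: "ys = ys' @ [a]" "a \<in> {1..s}" and zs: "zs = b # zs'" "b \<in> {1..s}"
      unfolding L_def R_def by (metis list.collapse append_butlast_last_id)
    have "successively ?D (ys' @ 0 # zs')" using b star[OF ys(2)] star[OF zs(2)] D0
      by (auto simp: ys zs successively_append_iff successively_Cons)
    moreover have "[a, 0, b] \<in> blocks3 s" using ys zs xs(2)
      by (auto simp: eq blocks3_def intro!: image_eqI[of _ _ "(a, b)"])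
    ultimately show ?thesis using that[of ys' "[a, 0, b]" zs'] 0 ys zs by (auto simp: eq)
  qed
qed

lemma card_blue_paths_le:
  assumes "2 \<le> t" "s < 2 * t"
  shows "card (mono_paths (2 * t) (3 * t - 1) (star_colouring t s) Blue)
    \<le> (2 * s * t + s * (s - 1)) * fact (2 * t - 2)"
proof -
  let ?A = "{..<2 * t}" and ?B = "{2 * t..<3 * t - 1}"
    and ?P = "mono_paths (2 * t) (3 * t - 1) (star_colouring t s) Blue"
  \<comment> \<open>A code consists of the block, the place \<open>p\<close> of \<open>0\<close>
    among the contracted path's vertices in \<open>?A\<close>, the other such vertices
    \<open>us\<close>, and the vertices \<open>bs\<close> in \<open>?B\<close>, which exhaust
    \<open>?B\<close>.\<close>
  define E2 where "E2 = (SIGMA c:blocks2 s. {..<t} \<times> arrangements (t - 1) (?A - set c) \<times> arrangements (t - 1) ?B)"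
  define E3 where "E3 = (SIGMA c:blocks3 s. {..<t - 1} \<times> arrangements (t - 2) (?A - set c) \<times> arrangements (t - 1) ?B)"
  define f where "f = (\<lambda>(c, p, us, bs). expand c (splice (take p us @ 0 # drop p us) bs))"
  define g where "g = (\<lambda>(c, p, us, bs). expand c (splice bs (take p us @ 0 # drop p us)))"
  have sub: "?P \<subseteq> f ` E2 \<union> f ` E3 \<union> g ` E3"
  proof
    fix xs assume P: "xs \<in> ?P"
    then have xs: "length xs = 2 * t" "distinct xs" "set xs \<subseteq> {..<3 * t - 1}"
      by (auto simp: mono_paths_def)
    have "1 \<le> t" using assms(1) by simp
    then obtain ys c zs where eq: "xs = ys @ c @ zs" "0 \<notin> set ys" "0 \<notin> set zs"
        and c: "c \<in> blocks2 s \<union> blocks3 s"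
        and alt: "successively (\<lambda>u v. (u < 2 * t) \<noteq> (v < 2 * t)) (ys @ 0 # zs)"
      using blue_path_contraction[OF P _ assms(2)] by metis
    define ws where "ws = ys @ 0 # zs"
    define as where "as = filter (\<lambda>x. x < 2 * t) ws"
    define bs where "bs = filter (\<lambda>x. \<not> x < 2 * t) ws"
    define p where "p = length (filter (\<lambda>x. x < 2 * t) ys)"
    define us where "us = filter (\<lambda>x. x < 2 * t) (ys @ zs)"
    have as: "as = take p us @ 0 # drop p us" using assms(1)
      by (simp add: as_def us_def p_def ws_def)
    have xs_ws: "xs = expand c ws" using eq by (simp add: ws_def expand_split)
    have "set us \<subseteq> ?A - set c" "distinct us"
      using xs(2) by (auto simp: us_def eq(1))
    then have us: "us \<in> arrangements (length us) (?A - set c)" by (simp add: arrangements_def)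
    have "distinct bs" "set bs \<subseteq> ?B" using xs assms(1) by (auto simp: bs_def ws_def eq(1))
    then have bs: "bs \<in> arrangements (length bs) ?B" by (simp add: arrangements_def)
    have "length bs \<le> card ?B" using \<open>distinct bs\<close> \<open>set bs \<subseteq> ?B\<close>
      by (metis card_mono distinct_card finite_atLeastLessThan)
    then have lbs: "length bs \<le> t - 1" by simp
    have las: "length as = Suc (length us)" "p \<le> length us" by (simp_all add: as p_def us_def)
    have split: "ws = (if ws \<noteq> [] \<and> hd ws < 2 * t then splice as bs else splice bs as)"
      unfolding as_def bs_def using alternating_splice[of "\<lambda>x. x < 2 * t" ws] alt by (simp add: ws_def)
    have len: "length as = (if hd ws < 2 * t then (length ws + 1) div 2 else length ws div 2)"
      unfolding as_def using length_filter_alternating[of "\<lambda>x. x < 2 * t" ws] alt by (simp add: ws_def)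
    have len': "length as + length bs = length ws"
      unfolding as_def bs_def by (rule sum_length_filter_compl)
    from c consider (two) "c \<in> blocks2 s" | (three) "c \<in> blocks3 s" by blast
    then show "xs \<in> f ` E2 \<union> f ` E3 \<union> g ` E3"
    proof cases
      case two
      then have "length ws = 2 * t - 1" using xs(1) by (auto simp: eq(1) ws_def blocks2_def)
      \<comment> \<open>The length is odd, so the class of the first vertex occurs \<open>t\<close>
        times, too often for \<open>?B\<close>.\<close>
      then have "hd ws < 2 * t" "length as = t" "length bs = t - 1"
        using len len' lbs assms(1) by (auto split: if_splits)
      then have "ws = splice as bs" using split by (auto simp: ws_def)
      then have "xs = f (c, p, us, bs)" by (simp add: f_def xs_ws as)
      moreover have "(c, p, us, bs) \<in> E2"
        using two us bs las \<open>length as = t\<close> \<open>length bs = t - 1\<close> by (auto simp: E2_def)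
      ultimately show ?thesis by blast
    next
      case three
      then have "length ws = 2 * t - 2" using xs(1) by (auto simp: eq(1) ws_def blocks3_def)
      then have l: "length as = t - 1" "length bs = t - 1"
        using len len' assms(1) by (auto split: if_splits)
      \<comment> \<open>The length is even, so either class may come first; hence \<open>E3\<close>
        is used with both \<open>f\<close> and \<open>g\<close>.\<close>
      have "ws = splice as bs \<or> ws = splice bs as" using split by meson
      then have "xs = f (c, p, us, bs) \<or> xs = g (c, p, us, bs)" by (auto simp: f_def g_def xs_ws as)
      moreover have "length us = t - 2" using l las assms(1) by linarith
      then have "(c, p, us, bs) \<in> E3"
        using three us bs las l assms(1) by (auto simp: E3_def)
      ultimately show ?thesis by blast
    qed
  qed
  have c2: "c \<in> blocks2 s \<Longrightarrow> card (?A - set c) = 2 * t - 2" for c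
    using assms by (auto simp: blocks2_def card_Diff_subset)
  have c3: "card (?A - set c) = 2 * t - 3" if c: "c \<in> blocks3 s" for c
  proof -
    have "distinct c" "length c = 3" "set c \<subseteq> ?A" using c assms(2) by (auto simp: blocks3_def)
    then show ?thesis by (simp add: card_Diff_subset distinct_card)
  qed
  have B: "card (arrangements (t - 1) ?B) = fact (t - 1)"
    by (rule card_arrangements_all) auto
  have fin: "finite (blocks2 s)" "finite (blocks3 s)" by (auto simp: blocks2_def blocks3_def)
  then have finE: "finite E2" "finite E3"
    unfolding E2_def E3_def by (auto intro!: finite_SigmaI finite_arrangements)
  have "card (blocks2 s) \<le> card ((\<lambda>a. [0, a]) ` {1..s}) + card ((\<lambda>a. [a, 0]) ` {1..s})"
    unfolding blocks2_def by (rule card_Un_le)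
  also have "\<dots> \<le> s + s"
    by (intro add_le_mono order_trans[OF card_image_le]) auto
  finally have card2: "card (blocks2 s) \<le> 2 * s" by simp
  have card3: "card (blocks3 s) \<le> s * (s - 1)"
    unfolding blocks3_def by (rule order_trans[OF card_image_le]) auto
  have "card E2 \<le> 2 * s * (t * fact (2 * t - 2))"
    unfolding E2_def
  proof (rule card_SIGMA_le[OF fin(1) card2])
    fix c assume c: "c \<in> blocks2 s"
    \<comment> \<open>The \<open>t - 1\<close> vertices left over in \<open>?A\<close> are as many
      as those of \<open>?B\<close>, so \<open>fact (t - 1)\<close> is also the number of orders of
      \<open>?B\<close>.\<close>
    have "2 * t - 2 - (t - 1) = t - 1" using assms(1) by simp
    then have "card (arrangements (t - 1) (?A - set c)) * fact (t - 1) = fact (2 * t - 2)"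
      using card_arrangements[of "?A - set c" "t - 1"] c2[OF c] assms(1) by simp
    then show "card ({..<t} \<times> arrangements (t - 1) (?A - set c) \<times> arrangements (t - 1) ?B) \<le> t * fact (2 * t - 2)"
      by (simp add: card_cartesian_product B[simplified])
  qed (auto simp: finite_arrangements)
  moreover have "card E3 \<le> s * (s - 1) * ((t - 1) * fact (2 * t - 3))"
    unfolding E3_def
  proof (rule card_SIGMA_le[OF fin(2) card3])
    fix c assume c: "c \<in> blocks3 s"
    have "2 * t - 3 - (t - 2) = t - 1" using assms(1) by simp
    then have "card (arrangements (t - 2) (?A - set c)) * fact (t - 1) = fact (2 * t - 3)"
      using card_arrangements[of "?A - set c" "t - 2"] c3[OF c] assms(1) by simp
    then show "card ({..<t - 1} \<times> arrangements (t - 2) (?A - set c) \<times> arrangements (t - 1) ?B) \<le> (t - 1) * fact (2 * t - 3)"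
      by (simp add: card_cartesian_product B[simplified])
  qed (auto simp: finite_arrangements)
  \<comment> \<open>The double use of \<open>E3\<close> supplies the factor 2 that completes
    \<open>fact (2 * t - 2)\<close>.\<close>
  moreover have "2 * ((t - 1) * fact (2 * t - 3)) = (fact (2 * t - 2) :: nat)"
    using assms(1) fact_reduce[of "2 * t - 2", where 'a = nat]
    by (simp add: numeral_3_eq_3 numeral_2_eq_2 algebra_simps)
  then have "2 * (s * (s - 1) * ((t - 1) * fact (2 * t - 3))) = s * (s - 1) * (fact (2 * t - 2) :: nat)"
    by (metis mult.left_commute)
  ultimately have "card E2 + card E3 + card E3 \<le> 2 * s * (t * fact (2 * t - 2)) + s * (s - 1) * fact (2 * t - 2)"
    by linarith
  moreover have "card ?P \<le> card E2 + card E3 + card E3"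
    using sub finE by (intro card_le_three_images)
  ultimately show ?thesis by (simp add: algebra_simps)
qed

section \<open>The multiplicity bound and its asymptotic form\<close>

lemma fact_double:
  assumes "1 \<le> t"
  shows "fact (2 * t) = 2 * real t * (2 * real t - 1) * fact (2 * t - 2)"
proof -
  obtain k where "t = Suc k" using assms by (cases t) auto
  then show ?thesis by (simp add: algebra_simps)
qed

lemma threshold_mult_even_path_le:
  assumes "3 \<le> t"
  shows "real (threshold_mult (path_graph (2 * t)))
    \<le> fact (2 * t) / 2 - real (t div 2) * real (t - t div 2) * fact (2 * t - 2)"
proof -
  \<comment> \<open>This choice maximises the saving \<open>s * (t - s)\<close>.\<close>
  define s where "s = t div 2"
  \<comment> \<open>With \<open>3 \<le> t\<close>, these make the natural subtractions below exact
    in the reals.\<close>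
  have s: "1 \<le> s" "s \<le> t" using assms by (auto simp: s_def)
  let ?\<chi> = "star_colouring t s"
  let ?N = "num_mono_copies (path_graph (2 * t)) (3 * t - 1) ?\<chi>"
  have "threshold_mult (path_graph (2 * t)) \<le> ?N"
    unfolding threshold_mult_def using assms by (intro Least_le exI[of _ ?\<chi>]) (simp add: ramsey_number_even_path)
  moreover have "2 * ?N \<le> ((2 * t - 1 - s) * (2 * t - s) + (2 * s * t + s * (s - 1))) * fact (2 * t - 2)"
    using double_card_mono_copies_le[of "2 * t" "3 * t - 1" ?\<chi> Red]
      double_card_mono_copies_le[of "2 * t" "3 * t - 1" ?\<chi> Blue]
      card_red_paths_le[of t s] card_blue_paths_le[of t s] assms s
    by (simp add: num_mono_copies_def add_mult_distrib)
  ultimately have "2 * threshold_mult (path_graph (2 * t))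
      \<le> ((2 * t - 1 - s) * (2 * t - s) + (2 * s * t + s * (s - 1))) * fact (2 * t - 2)"
    by linarith
  then have "real (2 * threshold_mult (path_graph (2 * t)))
      \<le> real (((2 * t - 1 - s) * (2 * t - s) + (2 * s * t + s * (s - 1))) * fact (2 * t - 2))"
    by (simp only: of_nat_le_iff)
  also have "\<dots> = ((2 * real t - 1 - real s) * (2 * real t - real s) + (2 * real s * real t + real s * (real s - 1)))
      * fact (2 * t - 2)"
    using s assms by (simp add: of_nat_diff)
  also have "\<dots> = (2 * real t * (2 * real t - 1) - 2 * (real s * (real t - real s))) * fact (2 * t - 2)"
    by (simp add: algebra_simps)
  also have "\<dots> = fact (2 * t) - 2 * (real s * real (t - s) * fact (2 * t - 2))"
    using fact_double[of t] s by (simp add: left_diff_distrib of_nat_diff)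
  finally show ?thesis by (simp add: s_def field_simps)
qed

lemma floor_square_quarter: "\<lfloor>(real t)\<^sup>2 / 4\<rfloor> = int (t div 2) * int (t - t div 2)"
proof (cases "even t")
  case True
  then obtain k where "t = 2 * k" by (elim evenE)
  then have "(real t)\<^sup>2 / 4 = of_int (int k * int k)" by (simp add: power2_eq_square)
  then show ?thesis using \<open>t = 2 * k\<close> by (simp only: floor_of_int) simp
next
  case False
  then obtain k where k: "t = 2 * k + 1" by (elim oddE)
  then have "(real t)\<^sup>2 / 4 = real (k * (k + 1)) + 1 / 4"
    by (simp add: power2_eq_square field_simps)
  also have "\<lfloor>\<dots>\<rfloor> = int (k * (k + 1))" by linarith
  finally show ?thesis using k by (simp add: algebra_simps)
qed

theorem theorem5:
  shows "(\<forall>t::nat. t \<ge> 3 \<longrightarrow>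
            real (threshold_mult (path_graph (2 * t)))
              \<le> fact (2 * t) / 2 - of_int \<lfloor>(real t)\<^sup>2 / 4\<rfloor> * fact (2 * t - 2)) \<and>
         (\<exists>\<epsilon>::nat \<Rightarrow> real. \<epsilon> \<longlonglongrightarrow> 0 \<and>
            (\<forall>t\<ge>3. real (threshold_mult (path_graph (2 * t)))
              \<le> (7 / 8 + \<epsilon> t) * (fact (2 * t) / 2)))"
proof -
  have bound: "real (threshold_mult (path_graph (2 * t)))
      \<le> fact (2 * t) / 2 - of_int \<lfloor>(real t)\<^sup>2 / 4\<rfloor> * fact (2 * t - 2)" if "3 \<le> t" for t
    using threshold_mult_even_path_le[OF that] by (simp add: floor_square_quarter)
  \<comment> \<open>In units of \<open>fact (2 * t - 2)\<close>, the saving is about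
    \<open>t^2 / 4\<close> out of \<open>t * (2 * t - 1)\<close>, an eighth in leading order;
    \<open>1 / t\<close> covers the lower-order terms and the loss of at most one unit by the
    floor.\<close>
  moreover have "(\<lambda>t. 1 / real t) \<longlonglongrightarrow> 0" by (rule lim_1_over_n)
  moreover have "real (threshold_mult (path_graph (2 * t))) \<le> (7 / 8 + 1 / real t) * (fact (2 * t) / 2)"
    if t: "3 \<le> t" for t
  proof -
    define F where "F = (fact (2 * t - 2) :: real)"
    have "F > 0" by (simp add: F_def)
    have fact: "fact (2 * t) = 2 * real t * (2 * real t - 1) * F"
      using fact_double[of t] t by (simp add: F_def)
    have "(real t)\<^sup>2 / 4 - 1 \<le> of_int \<lfloor>(real t)\<^sup>2 / 4\<rfloor>" by linarith
    then have "((real t)\<^sup>2 / 4 - 1) * F \<le> of_int \<lfloor>(real t)\<^sup>2 / 4\<rfloor> * F"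
      using \<open>F > 0\<close> by (intro mult_right_mono) auto
    then have "real (threshold_mult (path_graph (2 * t))) \<le> (real t * (2 * real t - 1) - ((real t)\<^sup>2 / 4 - 1)) * F"
      using bound[OF t] unfolding fact F_def[symmetric] by (simp add: algebra_simps)
    also have "\<dots> \<le> ((7 / 8 + 1 / real t) * (real t * (2 * real t - 1))) * F"
    proof (intro mult_right_mono)
      have "(7 / 8 + 1 / real t) * (real t * (2 * real t - 1)) = (7 / 8 * real t + 1) * (2 * real t - 1)"
        using t by (simp only: mult.assoc[symmetric] distrib_right) simp
      also have "\<dots> - (real t * (2 * real t - 1) - ((real t)\<^sup>2 / 4 - 1)) = 17 / 8 * real t - 2"
        by (simp add: field_simps power2_eq_square)
      finally show "real t * (2 * real t - 1) - ((real t)\<^sup>2 / 4 - 1)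
          \<le> (7 / 8 + 1 / real t) * (real t * (2 * real t - 1))"
        using t by linarith
    qed (use \<open>F > 0\<close> in simp)
    also have "\<dots> = (7 / 8 + 1 / real t) * (fact (2 * t) / 2)"
      unfolding fact by (simp add: mult.assoc)
    finally show ?thesis .
  qed
  ultimately show ?thesis by blast
qed

end
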